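(* Let $n$ be a positive integer and let $p$ be a prime dividing $n$. Let $\omega_1:=e^{2\pi i/p}$, $\omega_j:=\omega_1^j$ for $0\le j\le p-1$, and $B:=\{1,\omega_1,\ldots,\omega_{p-1}\}^n\subseteq\mathbb{C}^n$. Let $K(n,p)$ be the minimum $k$ for which there exist vectors $v_1,\ldots,v_k\in B$ such that for every $w\in B$ there is an $i\in\{1,\ldots,k\}$ with $v_i\cdot w=0$. Then $K(n,p)\ge n(p-1)$.
   Context: Here $v\cdot w=\sum_{l=1}^n v_l w_l$ denotes the usual (bilinear, non-conjugated) scalar product of $v=(v_1,\dots,v_n)$ and $w=(w_1,\dots,w_n)$. *)

theory Defs
  imports Complex_Main "HOL-Computational_Algebra.Primes"
begin

text \<open>Vectors in C^n are modelled as functions nat => complex, with coordinates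
  0..n-1 (and value 0 outside, to make set membership canonical).\<close>

definition omega :: "nat \<Rightarrow> nat \<Rightarrow> complex" where
  "omega p j = (cis (2 * pi / real p)) ^ j"

definition roots :: "nat \<Rightarrow> complex set" where
  "roots p = {omega p j | j. j \<le> p - 1}"

definition Bset :: "nat \<Rightarrow> nat \<Rightarrow> (nat \<Rightarrow> complex) set" where
  "Bset n p = {v. (\<forall>l<n. v l \<in> roots p) \<and> (\<forall>l\<ge>n. v l = 0)}"

definition dotp :: "nat \<Rightarrow> (nat \<Rightarrow> complex) \<Rightarrow> (nat \<Rightarrow> complex) \<Rightarrow> complex" where
  "dotp n v w = (\<Sum>l<n. v l * w l)"

definition Kval :: "nat \<Rightarrow> nat \<Rightarrow> nat" where
  "Kval n p = (LEAST k. \<exists>v :: nat \<Rightarrow> nat \<Rightarrow> complex.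
      (\<forall>i\<in>{1..k}. v i \<in> Bset n p) \<and>
      (\<forall>w\<in>Bset n p. \<exists>i\<in>{1..k}. dotp n (v i) w = 0))"

end

theory Submission
  imports Defs "HOL-Computational_Algebra.Computational_Algebra" "HOL-Number_Theory.Cong"
    "HOL-Library.FuncSet"
begin

text \<open>
  Write \<open>\<chi>(w)\<close> for the product of the coordinates of \<open>w\<close>. Irreducibility of the \<open>p\<close>-th
  cyclotomic polynomial shows that \<open>v \<cdot> w = 0\<close> forces \<open>\<chi>(v) \<chi>(w)\<close> to be a fixed root of unity
  \<open>\<kappa>\<close>. Hence the vectors \<open>v\<^sub>i\<close> with \<open>\<chi>(v\<^sub>i) = s\<close> must cover exactly the level set
  \<open>\<chi>(w) = \<kappa>/s\<close>, and it suffices that each of these \<open>p\<close> classes has at least \<open>n(p - 1)/p\<close> members.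

  If a class has \<open>d\<close> members, let \<open>f(w)\<close> be the product of its linear forms \<open>v\<^sub>i \<cdot> w\<close>. It is
  homogeneous of degree \<open>d\<close>, vanishes on the level set \<open>\<chi> = t\<close>, and is nonzero off it. Thus
  \<open>f \<cdot> \<Sum>\<^sub>j (\<chi>/t)^j = 0\<close> on \<open>B\<close>. Expanding in characters, a monomial \<open>w^b\<close> of \<open>f\<close> could only
  be cancelled by some \<open>w^a \<chi>^j\<close> with \<open>0 < j < p\<close>, \<open>w^a\<close> a monomial of \<open>f\<close> and
  \<open>b \<equiv> a + j\<close> modulo \<open>p\<close> in every coordinate. Then \<open>j a\<^sub>l + (p - j) b\<^sub>l \<ge> j (p - j)\<close> for all \<open>l\<close>, and
  summing over \<open>l\<close> gives \<open>p d \<ge> n j (p - j) \<ge> n (p - 1)\<close>.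
\<close>

subsection \<open>Vanishing sums of roots of unity\<close>

abbreviation int_poly_eval :: "int poly \<Rightarrow> 'a :: comm_ring_1 \<Rightarrow> 'a" where
  "int_poly_eval f z \<equiv> poly (map_poly of_int f) z"

lemma int_poly_eval_add: "int_poly_eval (f + g) z = int_poly_eval f z + int_poly_eval g z"
proof -
  have "map_poly of_int (f + g) = (map_poly of_int f + map_poly of_int g :: 'a poly)"
    by (intro poly_eqI) (simp add: coeff_map_poly)
  then show ?thesis by simp
qed

lemma int_poly_eval_mult: "int_poly_eval (f * g) z = int_poly_eval f z * int_poly_eval g z"
proof -
  have "map_poly of_int (f * g) = (map_poly of_int f * map_poly of_int g :: 'a poly)"
    by (intro poly_eqI) (simp add: coeff_map_poly coeff_mult)
  then show ?thesis by simp
qed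

lemma int_poly_eval_smult: "int_poly_eval (smult c f) z = of_int c * int_poly_eval f z"
proof -
  have "map_poly of_int (smult c f) = (smult (of_int c) (map_poly of_int f) :: 'a poly)"
    by (intro poly_eqI) (simp add: coeff_map_poly)
  then show ?thesis by simp
qed

lemma int_poly_eval_sum_monom:
  "int_poly_eval (\<Sum>l\<in>A. monom 1 (e l)) z = (\<Sum>l\<in>A. z ^ e l)"
  by (induction A rule: infinite_finite_induct)
     (simp_all add: int_poly_eval_add map_poly_monom poly_monom)

text \<open>As \<open>q\<^sup>2\<close> does not divide the constant term, one factor has constant
  term prime to \<open>q\<close>; reduction mod \<open>q\<close> then forces that factor to be
  constant.\<close>

lemma eisenstein_criterion:
  fixes f a b :: "int poly" and q :: int
  assumes q: "prime q" and f: "f = a * b"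
    and low: "\<And>i. i < degree f \<Longrightarrow> q dvd coeff f i"
    and lead: "\<not> q dvd lead_coeff f" and const: "\<not> q\<^sup>2 dvd coeff f 0"
  shows "degree a = 0 \<or> degree b = 0"
proof -
  have *: "degree v = 0" if uv: "f = u * v" and v0: "\<not> q dvd coeff v 0" for u v :: "int poly"
  proof -
    have nz: "u \<noteq> 0" "v \<noteq> 0" using uv lead by auto
    then have deg: "degree f = degree u + degree v" using uv by (simp add: degree_mult_eq)
    have "\<not> q dvd lead_coeff u" using lead uv by (auto simp: lead_coeff_mult)
    then have ex: "\<exists>k. \<not> q dvd coeff u k" by blast
    \<comment> \<open>Modulo \<open>q\<close>, \<open>coeff f k\<close> reduces to
      \<open>coeff u k * coeff v 0\<close>, which is nonzero, so \<open>k\<close> cannot lie below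
      \<open>degree f\<close>.\<close>
    define k where "k = (LEAST k. \<not> q dvd coeff u k)"
    have k: "\<not> q dvd coeff u k" using LeastI_ex[OF ex] by (simp add: k_def)
    have below: "q dvd coeff u i" if "i < k" for i
      using not_less_Least that unfolding k_def by blast
    have "coeff f k = coeff u k * coeff v 0 + (\<Sum>i<k. coeff u i * coeff v (k - i))"
      unfolding uv coeff_mult by (simp add: lessThan_Suc_atMost[symmetric])
    moreover have "q dvd (\<Sum>i<k. coeff u i * coeff v (k - i))"
      using below by (intro dvd_sum) auto
    moreover have "\<not> q dvd coeff u k * coeff v 0"
      using k v0 q by (simp add: prime_dvd_mult_iff)
    ultimately have "\<not> q dvd coeff f k" by (simp add: dvd_add_left_iff)
    then have "degree f \<le> k" using low by (meson not_le)
    moreover have "k \<le> degree u"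
      using k by (intro le_degree) auto
    ultimately show ?thesis using deg by simp
  qed
  have "\<not> q dvd coeff a 0 \<or> \<not> q dvd coeff b 0"
    using const unfolding f coeff_mult_0 power2_eq_square by (meson mult_dvd_mono)
  then show ?thesis
    using *[of a b] *[of b a] f by (auto simp: mult.commute)
qed

definition cyclotomic_prime :: "nat \<Rightarrow> int poly" where
  "cyclotomic_prime p = (\<Sum>i<p. monom 1 i)"

text \<open>The shifted polynomial is \<open>((x + 1) ^ p - 1) / x\<close>, whose coefficients suit
  Eisenstein at \<open>p\<close>.\<close>

lemma coeff_cyclotomic_prime_shifted:
  "coeff (pcompose (cyclotomic_prime p) [:1, 1:]) i = int (p choose (Suc i))"
proof -
  have "pcompose (monom 1 i) q = q ^ i" for i and q :: "int poly"
    by (induction i) (simp_all add: monom_Suc pcompose_pCons one_pCons)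
  then have "pcompose (cyclotomic_prime p) [:1, 1:] = (\<Sum>i<p. [:1, 1:] ^ i)"
    unfolding cyclotomic_prime_def by (simp add: pcompose_sum)
  then have "[:0, 1:] * pcompose (cyclotomic_prime p) [:1, 1:] = [:1, 1:] ^ p - 1"
    using power_diff_1_eq[of "[:1, 1:] :: int poly" p] by (simp add: one_pCons)
  then have "coeff ([:0, 1:] * pcompose (cyclotomic_prime p) [:1, 1:]) (Suc i)
      = coeff ([:1, 1:] ^ p - 1 :: int poly) (Suc i)" by simp
  moreover have "coeff ([:1, 1:] ^ p :: int poly) (Suc i) = int (p choose (Suc i))"
    by (cases "Suc i \<le> p")
       (auto simp: coeff_linear_poly_power binomial_eq_0
         intro!: coeff_eq_0 le_less_trans[OF degree_power_le])
  ultimately show ?thesis by simp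
qed

lemma cyclotomic_prime_factor:
  assumes p: "prime p" and f: "cyclotomic_prime p = a * b"
  shows "degree a = 0 \<or> degree b = 0"
proof -
  let ?s = "\<lambda>f. pcompose f [:1, 1 :: int:]"
  have p1: "p > 1" using p prime_gt_1_nat by blast
  note c = coeff_cyclotomic_prime_shifted[of p]
  have deg: "degree (?s (cyclotomic_prime p)) = p - 1"
  proof (rule antisym)
    show "degree (?s (cyclotomic_prime p)) \<le> p - 1"
      by (rule degree_le) (auto simp: c)
    show "p - 1 \<le> degree (?s (cyclotomic_prime p))"
      by (rule le_degree) (use p1 in \<open>simp add: c\<close>)
  qed
  have "degree (?s a) = 0 \<or> degree (?s b) = 0"
  proof (rule eisenstein_criterion)
    show "prime (int p)" using p by simp
    show "?s (cyclotomic_prime p) = ?s a * ?s b" by (simp add: f pcompose_mult)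
    show "int p dvd coeff (?s (cyclotomic_prime p)) i"
      if "i < degree (?s (cyclotomic_prime p))" for i
      using that p unfolding deg c
      by (auto intro!: dvd_choose_prime simp: int_dvd_int_iff)
    show "\<not> int p dvd lead_coeff (?s (cyclotomic_prime p))"
      using p1 unfolding deg c by simp
    show "\<not> (int p)\<^sup>2 dvd coeff (?s (cyclotomic_prime p)) 0"
      using p1 unfolding c by (simp add: power2_eq_square)
  qed
  then show ?thesis by (simp add: degree_pcompose)
qed

text \<open>The primitive part \<open>m\<close> of a least-degree annihilator of \<open>z\<close>
  divides every integer polynomial vanishing at \<open>z\<close>. Irreducibility identifies
  \<open>m\<close> with the cyclotomic polynomial up to a unit. Divisibility over the integers is
  what later allows reduction mod \<open>p\<close>.\<close>

lemma cyclotomic_prime_dvd: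
  fixes z :: "'a :: field_char_0"
  assumes p: "prime p" and z: "z ^ p = 1" "z \<noteq> 1" and f: "int_poly_eval f z = 0"
  shows "cyclotomic_prime p dvd f"
proof -
  define C where "C = cyclotomic_prime p"
  have Cz: "int_poly_eval C z = 0"
    unfolding C_def cyclotomic_prime_def int_poly_eval_sum_monom
    using z by (simp add: geometric_sum)
  have C0: "coeff C 0 = 1"
    unfolding C_def cyclotomic_prime_def using p prime_gt_0_nat[of p]
    by (simp add: coeff_sum)
  then have Cnz: "C \<noteq> 0" by auto
  define P where "P = (\<lambda>m. m \<noteq> 0 \<and> int_poly_eval m z = 0)"
  obtain m0 where m0: "P m0" "\<And>g. P g \<Longrightarrow> degree m0 \<le> degree g"
    using ex_has_least_nat[of P C degree] Cnz Cz by (auto simp: P_def)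
  define m where "m = primitive_part m0"
  have m_nz: "m \<noteq> 0" and m_content: "content m = 1" and m_deg: "degree m = degree m0"
    using m0(1) by (auto simp: m_def P_def)
  have "int_poly_eval m0 z = of_int (content m0) * int_poly_eval m z"
    unfolding m_def by (subst int_poly_eval_smult[symmetric]) simp
  then have mz: "int_poly_eval m z = 0" using m0(1) by (auto simp: P_def)
  have m_dvd: "m dvd g" if g: "int_poly_eval g z = 0" for g
  proof -
    obtain a q where aq: "a \<noteq> 0" "smult a g = m * q + pseudo_mod g m"
      using pseudo_mod(1)[OF m_nz] by blast
    have "int_poly_eval (pseudo_mod g m) z = 0"
      using arg_cong[OF aq(2), of "\<lambda>h. int_poly_eval h z"] g mz
      by (simp add: int_poly_eval_add int_poly_eval_mult int_poly_eval_smult)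
    then have "pseudo_mod g m = 0"
      using pseudo_mod(2)[OF m_nz, of g] m0(2)[of "pseudo_mod g m"] m_deg
      unfolding P_def by linarith
    then have "smult a g = m * q" using aq by simp
    \<comment> \<open>Gauss's lemma: the factor \<open>a\<close> from pseudo-division is a unit over
      the fraction field, and primitivity of \<open>m\<close> brings divisibility back to the
      integers.\<close>
    then have "fract_poly m dvd smult (to_fract a) (fract_poly g)"
      by (metis dvd_triv_left fract_poly_dvd fract_poly_smult)
    then have "fract_poly m dvd fract_poly g"
      using aq(1) by (simp add: dvd_smult_iff)
    then show ?thesis using fract_poly_dvdD m_content by blast
  qed
  obtain q where q: "C = m * q" using m_dvd[OF Cz] by blast
  have "degree m \<noteq> 0"
  proof
    assume "degree m = 0"
    then obtain c where "m = [:c:]" by (meson degree_eq_zeroE)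
    then show False using mz m_nz by (simp add: map_poly_pCons)
  qed
  then have "degree q = 0" using cyclotomic_prime_factor[OF p, of m q] q by (simp add: C_def)
  then obtain c where c: "q = [:c:]" by (meson degree_eq_zeroE)
  then have "coeff m 0 * c = 1" using C0 q by (simp add: mult.commute)
  then have "is_unit q" using c by (metis dvd_triv_right is_unit_const_poly_iff)
  then have "C dvd m" unfolding q by (simp add: mult_unit_dvd_iff)
  then show ?thesis using m_dvd[OF f] dvd_trans unfolding C_def by blast
qed

text \<open>Compare values and first derivatives at 1 in
  \<open>(\<Sum>l. x ^ a l) = (1 + x + \<dots> + x ^ (p - 1)) * Q\<close>.\<close>

lemma vanishing_sum_exponents:
  fixes z :: "'a :: field_char_0" and a :: "nat \<Rightarrow> nat"
  assumes p: "prime p" and z: "z ^ p = 1" "z \<noteq> 1" and s: "(\<Sum>l<n. z ^ a l) = 0"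
  shows "[(\<Sum>l<n. a l) = (\<Sum>i<p. i) * (n div p)] (mod p)"
proof -
  have "int_poly_eval (\<Sum>l<n. monom 1 (a l)) z = 0"
    unfolding int_poly_eval_sum_monom by (rule s)
  then obtain Q where Q: "(\<Sum>l<n. monom 1 (a l)) = cyclotomic_prime p * Q"
    using cyclotomic_prime_dvd[OF p z] by blast
  have one: "poly (\<Sum>i<k. monom 1 (e i)) 1 = int k" for k :: nat and e :: "nat \<Rightarrow> nat"
    by (simp add: poly_sum poly_monom)
  have deriv: "poly (pderiv (\<Sum>i<k. monom 1 (e i))) 1 = int (\<Sum>i<k. e i)"
    for k and e :: "nat \<Rightarrow> nat"
    by (induction k) (simp_all add: pderiv_add pderiv_monom poly_monom)
  have n: "int n = int p * poly Q 1"
    using arg_cong[OF Q, of "\<lambda>f. poly f 1"] one[of a n] one[of "\<lambda>i. i" p]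
    by (simp add: cyclotomic_prime_def)
  then have "poly Q 1 = int (n div p)"
    using p prime_gt_0_nat[of p] by (simp add: zdiv_int)
  moreover have "int (\<Sum>l<n. a l) = int p * poly (pderiv Q) 1 + int (\<Sum>i<p. i) * poly Q 1"
    using arg_cong[OF Q, of "\<lambda>f. poly (pderiv f) 1"] deriv[of a n] deriv[of "\<lambda>i. i" p]
      one[of "\<lambda>i. i" p]
    by (simp add: cyclotomic_prime_def pderiv_mult mult.commute)
  ultimately have "[int (\<Sum>l<n. a l) = int ((\<Sum>i<p. i) * (n div p))] (mod int p)"
    by (simp add: cong_def)
  then show ?thesis by (simp only: cong_int_iff)
qed

subsection \<open>The group of vectors of roots of unity\<close>

lemma roots_eq:
  assumes "p > 0"
  shows "roots p = {z. z ^ p = 1}"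
proof -
  have "roots p = (\<lambda>k. cis (2 * pi * real k / real p)) ` {..<p}"
  proof -
    have "{j. j \<le> p - 1} = {..<p}" using assms by auto
    moreover have "omega p j = cis (2 * pi * real j / real p)" for j
      by (simp add: omega_def DeMoivre mult_ac)
    moreover have "roots p = omega p ` {j. j \<le> p - 1}" by (auto simp: roots_def)
    ultimately show ?thesis by simp
  qed
  then show ?thesis
    using bij_betw_roots_unity[OF assms] by (simp add: bij_betw_def)
qed

lemma primitive_root_in_roots: "p > 0 \<Longrightarrow> cis (2 * pi / real p) \<in> roots p"
  by (simp add: roots_eq DeMoivre)

lemma primitive_root_power_eq_1_iff:
  assumes "p > 0"
  shows "cis (2 * pi / real p) ^ k = 1 \<longleftrightarrow> p dvd k"
proof -
  let ?z = "cis (2 * pi / real p)"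
  have zp: "?z ^ p = 1" using assms by (simp add: DeMoivre)
  have "?z ^ k = ?z ^ (k mod p)"
    using power_add[of ?z "p * (k div p)" "k mod p"] zp by (simp add: power_mult)
  moreover have "?z ^ (k mod p) = 1 \<longleftrightarrow> k mod p = 0"
  proof
    assume "?z ^ (k mod p) = 1"
    then have "cis (2 * pi * real (k mod p) / real p) = cis (2 * pi * real 0 / real p)"
      by (simp add: DeMoivre mult_ac)
    then show "k mod p = 0"
      using bij_betw_imp_inj_on[OF bij_betw_roots_unity[OF assms]] assms
      unfolding inj_on_def by (metis lessThan_iff mod_less_divisor)
  qed simp
  ultimately show ?thesis by (simp add: dvd_eq_mod_eq_0)
qed

text \<open>Roots of unity have modulus 1, so conjugation inverts them; the form
  \<open>z ^ (p - 1)\<close> keeps exponents natural.\<close>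

lemma cnj_roots:
  assumes "p > 0" "z \<in> roots p"
  shows "cnj z = z ^ (p - 1)" "cnj z * z = 1" "cnj z \<in> roots p"
proof -
  have z: "z ^ p = 1" using assms by (simp add: roots_eq)
  then have "norm z = 1" using assms(1)
    by (metis norm_one norm_power power_eq_1_iff norm_ge_zero less_not_refl)
  then show 1: "cnj z * z = 1" by (metis complex_norm_square mult.commute of_real_1 power_one)
  have "z ^ (p - 1) * z = 1" using z assms(1) by (simp add: power_eq_if mult.commute)
  with 1 show "cnj z = z ^ (p - 1)"
    by (metis mult_cancel_right mult_zero_right zero_neq_one)
  show "cnj z \<in> roots p" using z assms(1) by (simp add: roots_eq flip: complex_cnj_power)
qed

lemma roots_mult: "p > 0 \<Longrightarrow> y \<in> roots p \<Longrightarrow> z \<in> roots p \<Longrightarrow> y * z \<in> roots p"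
  by (simp add: roots_eq power_mult_distrib)

lemma roots_power:
  assumes "p > 0" "z \<in> roots p"
  shows "z ^ k \<in> roots p"
proof -
  have "(z ^ k) ^ p = (z ^ p) ^ k" by (simp only: power_mult[symmetric] mult.commute)
  then show ?thesis using assms by (simp add: roots_eq)
qed

lemma one_in_roots: "p > 0 \<Longrightarrow> 1 \<in> roots p"
  by (simp add: roots_eq)

lemma finite_roots: "p > 0 \<Longrightarrow> finite (roots p)"
  by (simp add: roots_eq finite_roots_unity Suc_le_eq)

lemma finite_Bset:
  assumes "p > 0"
  shows "finite (Bset n p)"
proof -
  have "Bset n p = {f. \<forall>x. (x \<in> {..<n} \<longrightarrow> f x \<in> roots p) \<and> (x \<notin> {..<n} \<longrightarrow> f x = 0)}"
    by (auto simp: Bset_def not_less)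
  then show ?thesis
    using finite_set_of_finite_funs[OF finite_lessThan[of n] finite_roots[OF assms], of 0] by simp
qed

text \<open>\<open>Bset n p\<close> is a group under coordinatewise multiplication, so multiplying
  by \<open>u\<close> permutes it.\<close>

lemma sum_Bset_translate:
  assumes p: "p > 0" and u: "u \<in> Bset n p"
  shows "(\<Sum>w\<in>Bset n p. F (\<lambda>l. u l * w l)) = (\<Sum>w\<in>Bset n p. F w)"
proof (rule sum.reindex_bij_witness[where j = "\<lambda>w l. u l * w l" and i = "\<lambda>w l. cnj (u l) * w l"])
  have inv: "u l \<noteq> 0 \<Longrightarrow> cnj (u l) * u l = 1" "u l = 0 \<longleftrightarrow> l \<ge> n" for l
    using u cnj_roots[OF p, of "u l"] by (cases "l < n"; force simp: Bset_def)+
  fix w assume w: "w \<in> Bset n p"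
  have w0: "w l = 0" if "l \<ge> n" for l using w that by (simp add: Bset_def)
  \<comment> \<open>From index \<open>n\<close> on, \<open>u l\<close> is 0 and not invertible, but
    there \<open>w l\<close> is 0 too.\<close>
  have *: "cnj (u l) * (u l * w l) = w l" "u l * (cnj (u l) * w l) = w l" for l
    using inv[of l] w0[of l] by (cases "l < n"; simp add: mult.assoc[symmetric] mult.commute)+
  show "(\<lambda>l. cnj (u l) * (u l * w l)) = w" "(\<lambda>l. u l * (cnj (u l) * w l)) = w"
    using * by auto
  show "(\<lambda>l. u l * w l) \<in> Bset n p" "(\<lambda>l. cnj (u l) * w l) \<in> Bset n p"
    using u w cnj_roots[OF p] by (auto simp: Bset_def intro!: roots_mult[OF p])
qed simp

text \<open>A nontrivial character sums to zero: translating coordinate \<open>l0\<close> by a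
  primitive root multiplies the sum by a factor other than 1.\<close>

lemma sum_monomial_Bset:
  fixes k :: "nat \<Rightarrow> nat"
  assumes p: "p > 0" and l0: "l0 < n" "\<not> p dvd k l0"
  shows "(\<Sum>w\<in>Bset n p. \<Prod>l<n. w l ^ k l) = 0"
proof -
  let ?z = "cis (2 * pi / real p)"
  define u where "u = (\<lambda>l. if l = l0 then ?z else if l < n then 1 else 0)"
  have u: "u \<in> Bset n p"
    using l0 p by (auto simp: Bset_def u_def primitive_root_in_roots one_in_roots)
  have "(\<Prod>l<n. u l ^ k l) = (\<Prod>l<n. if l = l0 then ?z ^ k l0 else 1)"
    by (intro prod.cong) (auto simp: u_def)
  then have pu: "(\<Prod>l<n. u l ^ k l) = ?z ^ k l0" using l0 by simp
  have "(\<Sum>w\<in>Bset n p. \<Prod>l<n. w l ^ k l) = (\<Sum>w\<in>Bset n p. \<Prod>l<n. (u l * w l) ^ k l)"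
    by (rule sum_Bset_translate[OF p u, symmetric])
  also have "\<dots> = ?z ^ k l0 * (\<Sum>w\<in>Bset n p. \<Prod>l<n. w l ^ k l)"
    by (simp add: power_mult_distrib prod.distrib pu sum_distrib_left)
  finally show ?thesis
    using primitive_root_power_eq_1_iff[OF p, of "k l0"] l0(2) by simp
qed

lemma prod_Bset_in_roots: "p > 0 \<Longrightarrow> w \<in> Bset n p \<Longrightarrow> (\<Prod>l<n. w l) \<in> roots p"
  by (simp add: roots_eq Bset_def prod_power_distrib)

text \<open>Each \<open>v l * w l\<close> is a power of the primitive root, and a vanishing sum
  fixes the total exponent mod \<open>p\<close>.\<close>

lemma dotp_eq_0_imp_prod:
  assumes p: "prime p" and v: "v \<in> Bset n p" and w: "w \<in> Bset n p" and 0: "dotp n v w = 0"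
  shows "(\<Prod>l<n. v l) * (\<Prod>l<n. w l) = omega p ((\<Sum>i<p. i) * (n div p))"
proof -
  let ?z = "cis (2 * pi / real p)"
  have p1: "p > 1" using p prime_gt_1_nat by blast
  have zp: "?z ^ p = 1" using p1 by (simp add: primitive_root_power_eq_1_iff)
  have z1: "?z \<noteq> 1" using primitive_root_power_eq_1_iff[of p 1] p1 by simp
  have "\<exists>a. v l * w l = ?z ^ a" if "l < n" for l
  proof -
    have "v l * w l \<in> roots p" using v w that p1 by (auto simp: Bset_def intro: roots_mult)
    then show ?thesis by (auto simp: roots_def omega_def)
  qed
  then obtain a where a: "\<And>l. l < n \<Longrightarrow> v l * w l = ?z ^ a l" by metis
  have "(\<Sum>l<n. ?z ^ a l) = 0" using 0 a by (simp add: dotp_def)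
  then have cong: "[(\<Sum>l<n. a l) = (\<Sum>i<p. i) * (n div p)] (mod p)"
    by (rule vanishing_sum_exponents[OF p zp z1])
  have red: "?z ^ k = ?z ^ (k mod p)" for k
    using power_add[of ?z "p * (k div p)" "k mod p"] zp by (simp add: power_mult)
  have "(\<Prod>l<n. v l) * (\<Prod>l<n. w l) = ?z ^ (\<Sum>l<n. a l)"
    using a by (simp add: power_sum flip: prod.distrib)
  also have "\<dots> = ?z ^ ((\<Sum>i<p. i) * (n div p))"
    using cong red by (metis cong_def)
  finally show ?thesis by (simp add: omega_def)
qed

subsection \<open>Covering a level set of the coordinate product\<close>

text \<open>The hypothesis encodes \<open>b \<equiv> a + j\<close> mod \<open>p\<close>, with
  \<open>p - 1\<close> standing for -1. Either \<open>a \<ge> p - j\<close>, or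
  \<open>a + j < p\<close> and hence \<open>b \<ge> j\<close>; one summand then suffices.\<close>

lemma shifted_exponents_weighted:
  fixes a b j p :: nat
  assumes "0 < j" "j < p" "p dvd a + j + (p - 1) * b"
  shows "j * (p - j) \<le> j * a + (p - j) * b"
proof (cases "p - j \<le> a")
  case True
  then show ?thesis by (simp add: trans_le_add1)
next
  case False
  have "a + j + (p - 1) * b + b = p * b + (a + j)" using assms by (cases p) simp_all
  then have "[b = a + j] (mod p)"
    using assms(3) by (metis cong_def dvd_imp_mod_0 mod_add_left_eq add_0 mod_mult_self4)
  then have "b mod p = a + j" using False by (simp add: cong_def)
  then have "j \<le> b" using mod_less_eq_dividend[of b p] by simp
  then have "(p - j) * j \<le> (p - j) * b" by (rule mult_le_mono2)
  then show ?thesis by (metis mult.commute trans_le_add2)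
qed

text \<open>If \<open>I\<close> were too small, \<open>f\<close> would be orthogonal on
  \<open>Bset n p\<close> to each of its own monomials, hence to itself, and so vanish there;
  \<open>w0\<close> excludes this.\<close>

lemma level_set_cover_bound:
  fixes v :: "'i \<Rightarrow> nat \<Rightarrow> complex"
  assumes p: "p > 0" and I: "finite I" and t: "t \<in> roots p"
    and cover: "\<And>w. w \<in> Bset n p \<Longrightarrow> (\<Prod>l<n. w l) = t \<Longrightarrow> \<exists>i\<in>I. dotp n (v i) w = 0"
    and w0: "w0 \<in> Bset n p" "\<And>i. i \<in> I \<Longrightarrow> dotp n (v i) w0 \<noteq> 0"
  shows "n * (p - 1) \<le> p * card I"
proof (rule ccontr)
  assume less: "\<not> n * (p - 1) \<le> p * card I"
  define f where "f = (\<lambda>w. \<Prod>i\<in>I. dotp n (v i) w)"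
  \<comment> \<open>Multiplying out \<open>f\<close>, \<open>g\<close> chooses a coordinate from
    each linear form; \<open>c g\<close> and \<open>e g\<close> are the resulting coefficient and
    exponents. Equal monomials are not merged.\<close>
  define G where "G = I \<rightarrow>\<^sub>E {..<n}"
  define c where "c = (\<lambda>g. \<Prod>i\<in>I. v i (g i))"
  define e where "e = (\<lambda>g l. card {i \<in> I. g i = (l::nat)})"
  define mon where "mon = (\<lambda>g w. \<Prod>l<n. (w l :: complex) ^ e g l)"
  define \<chi> where "\<chi> = (\<lambda>w. \<Prod>l<n. (w l :: complex))"
  have f_expand: "f w = (\<Sum>g\<in>G. c g * mon g w)" for w
  proof -
    have "f w = (\<Sum>g\<in>G. \<Prod>i\<in>I. v i (g i) * w (g i))"
      unfolding f_def dotp_def G_def by (rule prod_sum_PiE) (use I in auto)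
    also have "\<dots> = (\<Sum>g\<in>G. c g * mon g w)"
    proof (rule sum.cong[OF refl])
      fix g assume g: "g \<in> G"
      have "(\<Prod>i\<in>I. w (g i)) = (\<Prod>l<n. \<Prod>i\<in>{i \<in> I. g i = l}. w (g i))"
        using I g by (intro prod.group[symmetric]) (auto simp: G_def)
      also have "\<dots> = mon g w" by (simp add: mon_def e_def)
      finally show "(\<Prod>i\<in>I. v i (g i) * w (g i)) = c g * mon g w"
        by (simp add: prod.distrib c_def)
    qed
    finally show ?thesis .
  qed
  have e_sum: "(\<Sum>l<n. e g l) = card I" if "g \<in> G" for g
  proof -
    have "(\<Sum>l<n. \<Sum>i\<in>{i \<in> I. g i = l}. 1) = (\<Sum>i\<in>I. 1 :: nat)"
      using I that by (intro sum.group) (auto simp: G_def)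
    then show ?thesis by (simp add: e_def)
  qed
  have ortho: "(\<Sum>w\<in>Bset n p. mon g' w * \<chi> w ^ j * cnj (mon g w)) = 0"
    if g: "g \<in> G" "g' \<in> G" and j: "0 < j" "j < p" for g g' j
  proof -
    define k where "k = (\<lambda>l. e g' l + j + (p - 1) * e g l)"
    have "mon g' w * \<chi> w ^ j * cnj (mon g w) = (\<Prod>l<n. w l ^ k l)" if "w \<in> Bset n p" for w
    proof -
      have "cnj (w l) = w l ^ (p - 1)" if "l < n" for l
        using \<open>w \<in> Bset n p\<close> that cnj_roots(1)[OF p] by (simp add: Bset_def)
      then show ?thesis
        by (simp add: mon_def \<chi>_def k_def prod_power_distrib power_add power_mult flip: prod.distrib)
    qed
    then have "(\<Sum>w\<in>Bset n p. mon g' w * \<chi> w ^ j * cnj (mon g w)) = (\<Sum>w\<in>Bset n p. \<Prod>l<n. w l ^ k l)"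
      by simp
    also have "\<dots> = 0"
    proof (rule ccontr)
      assume "(\<Sum>w\<in>Bset n p. \<Prod>l<n. w l ^ k l) \<noteq> 0"
      \<comment> \<open>A nonzero sum makes every exponent divisible by \<open>p\<close>; the
        weighted bounds are then added up, both monomials having degree
        \<open>card I\<close>.\<close>
      then have "p dvd k l" if "l < n" for l using sum_monomial_Bset[OF p that] by blast
      then have "j * (p - j) \<le> j * e g' l + (p - j) * e g l" if "l < n" for l
        using shifted_exponents_weighted[OF j] that by (simp add: k_def)
      then have "(\<Sum>l<n. j * (p - j)) \<le> (\<Sum>l<n. j * e g' l + (p - j) * e g l)"
        by (intro sum_mono) simp
      also have "\<dots> = j * card I + (p - j) * card I"
        using e_sum g by (simp add: sum.distrib flip: sum_distrib_left)
      also have "\<dots> = p * card I" using j by (simp flip: distrib_right)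
      finally have "n * (j * (p - j)) \<le> p * card I" by simp
      moreover have "p - 1 \<le> j * (p - j)"
      proof -
        obtain x y where "j = Suc x" "p - j = Suc y" using j by (metis Suc_pred zero_less_diff)
        then show ?thesis using j by simp
      qed
      ultimately show False using less by (meson le_trans mult_le_mono2)
    qed
    finally show ?thesis .
  qed
  \<comment> \<open>The geometric sum vanishes off the level set, and \<open>f\<close> vanishes on
    it.\<close>
  have zero: "f w * (\<Sum>j<p. (cnj t * \<chi> w) ^ j) = 0" if w: "w \<in> Bset n p" for w
  proof (cases "\<chi> w = t")
    case True
    then show ?thesis using cover[OF w] I by (simp add: f_def \<chi>_def)
  next
    case False
    have "cnj t * \<chi> w \<in> roots p"
      using prod_Bset_in_roots[OF p w] cnj_roots(3)[OF p t] roots_mult[OF p] by (simp add: \<chi>_def)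
    moreover have "cnj t * \<chi> w \<noteq> 1"
      using False cnj_roots(2)[OF p t]
      by (metis mult_cancel_left mult_zero_left zero_neq_one)
    ultimately show ?thesis using p by (simp add: geometric_sum roots_eq)
  qed
  have coeff0: "(\<Sum>w\<in>Bset n p. f w * cnj (mon g w)) = 0" if g: "g \<in> G" for g
  proof -
    \<comment> \<open>Pairing the identity \<open>zero\<close> with a monomial leaves only
      \<open>T 0\<close>, since \<open>ortho\<close> kills every other \<open>T j\<close>.\<close>
    define T where "T = (\<lambda>j. \<Sum>w\<in>Bset n p. f w * \<chi> w ^ j * cnj (mon g w))"
    have T: "T j = 0" if "0 < j" "j < p" for j
    proof -
      have "T j = (\<Sum>w\<in>Bset n p. \<Sum>g'\<in>G. c g' * (mon g' w * \<chi> w ^ j * cnj (mon g w)))"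
        by (simp add: T_def f_expand sum_distrib_right mult.assoc)
      also have "\<dots> = (\<Sum>g'\<in>G. c g' * (\<Sum>w\<in>Bset n p. mon g' w * \<chi> w ^ j * cnj (mon g w)))"
        by (subst sum.swap) (simp add: sum_distrib_left)
      also have "\<dots> = 0" using ortho[OF g _ that] by simp
      finally show ?thesis .
    qed
    have "0 = (\<Sum>w\<in>Bset n p. f w * (\<Sum>j<p. (cnj t * \<chi> w) ^ j) * cnj (mon g w))"
      by (rule sym, rule sum.neutral) (metis zero mult_zero_left)
    also have "\<dots> = (\<Sum>w\<in>Bset n p. \<Sum>j<p. cnj t ^ j * (f w * \<chi> w ^ j * cnj (mon g w)))"
      by (simp add: sum_distrib_left sum_distrib_right power_mult_distrib mult_ac)
    also have "\<dots> = (\<Sum>j<p. cnj t ^ j * T j)"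
      by (subst sum.swap) (simp add: T_def sum_distrib_left)
    also have "\<dots> = (\<Sum>j<p. if j = 0 then T 0 else 0)"
      using T by (intro sum.cong) auto
    also have "\<dots> = T 0" using p by simp
    finally show ?thesis by (simp add: T_def)
  qed
  have "of_real (\<Sum>w\<in>Bset n p. (norm (f w))\<^sup>2) = (\<Sum>w\<in>Bset n p. f w * cnj (f w))"
    unfolding of_real_sum complex_norm_square ..
  also have "\<dots> = (\<Sum>w\<in>Bset n p. \<Sum>g\<in>G. cnj (c g) * (f w * cnj (mon g w)))"
    by (subst (2) f_expand) (simp add: sum_distrib_left mult_ac)
  also have "\<dots> = (\<Sum>g\<in>G. cnj (c g) * (\<Sum>w\<in>Bset n p. f w * cnj (mon g w)))"
    by (subst sum.swap) (simp add: sum_distrib_left)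
  also have "\<dots> = 0" using coeff0 by simp
  finally have "(\<Sum>w\<in>Bset n p. (norm (f w))\<^sup>2) = 0" using of_real_eq_0_iff by blast
  then have "f w0 = 0"
    using w0(1) finite_Bset[OF p] by (simp add: sum_nonneg_eq_0_iff)
  then show False using w0(2) I by (simp add: f_def)
qed

subsection \<open>Orthogonal covers\<close>

text \<open>Repeats the condition under \<open>LEAST\<close> in \<open>Kval\<close>, so that
  \<open>LeastI_ex\<close> applies after unfolding.\<close>

definition orthogonal_cover :: "nat \<Rightarrow> nat \<Rightarrow> nat \<Rightarrow> (nat \<Rightarrow> nat \<Rightarrow> complex) \<Rightarrow> bool" where
  "orthogonal_cover n p k v \<longleftrightarrow> (\<forall>i\<in>{1..k}. v i \<in> Bset n p) \<and>
      (\<forall>w\<in>Bset n p. \<exists>i\<in>{1..k}. dotp n (v i) w = 0)"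

text \<open>Ensures that the minimum is attained. All of \<open>Bset n p\<close> is a cover:
  twisting the conjugate of \<open>w\<close> by powers of the primitive root gives a geometric sum
  that vanishes as \<open>p dvd n\<close>.\<close>

lemma ex_orthogonal_cover:
  assumes p: "p > 1" and "p dvd n"
  shows "\<exists>k v. orthogonal_cover n p k v"
proof -
  let ?z = "cis (2 * pi / real p)"
  have p0: "p > 0" using p by simp
  obtain h where h: "bij_betw h {1..card (Bset n p)} (Bset n p)"
    using ex_bij_betw_nat_finite_1[OF finite_Bset[OF p0]] by blast
  have "\<exists>v\<in>Bset n p. dotp n v w = 0" if w: "w \<in> Bset n p" for w
  proof
    define v where "v = (\<lambda>l. if l < n then cnj (w l) * ?z ^ l else 0)"
    have "?z ^ l \<in> roots p" for l
      by (intro roots_power primitive_root_in_roots p0)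
    then show "v \<in> Bset n p"
      using w cnj_roots(3)[OF p0] by (auto simp: Bset_def v_def intro!: roots_mult[OF p0])
    have "v l * w l = ?z ^ l" if "l < n" for l
      using that w cnj_roots(2)[OF p0, of "w l"] by (simp add: Bset_def v_def mult_ac)
    then have "dotp n v w = (\<Sum>l<n. ?z ^ l)" by (simp add: dotp_def)
    also have "\<dots> = 0"
      using primitive_root_power_eq_1_iff[OF p0, of 1] primitive_root_power_eq_1_iff[OF p0, of n] assms
      by (simp add: geometric_sum)
    finally show "dotp n v w = 0" .
  qed
  then have "orthogonal_cover n p (card (Bset n p)) h"
    using h unfolding orthogonal_cover_def bij_betw_def by (metis image_eqI image_iff)
  then show ?thesis by blast
qed

lemma orthogonal_cover_size:
  assumes n: "n > 0" and p: "prime p" and cov: "orthogonal_cover n p k v"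
  shows "n * (p - 1) \<le> k"
proof -
  let ?z = "cis (2 * pi / real p)"
  define \<chi> where "\<chi> = (\<lambda>w. \<Prod>l<n. (w l :: complex))"
  define \<kappa> where "\<kappa> = omega p ((\<Sum>i<p. i) * (n div p))"
  define I where "I = (\<lambda>s. {i \<in> {1..k}. \<chi> (v i) = s})"
  have p1: "p > 1" and p0: "p > 0" using prime_gt_1_nat[OF p] by simp_all
  have vB: "v i \<in> Bset n p" if "i \<in> {1..k}" for i using cov that by (simp add: orthogonal_cover_def)
  have \<kappa>: "\<kappa> \<in> roots p"
    unfolding \<kappa>_def omega_def by (intro roots_power primitive_root_in_roots p0)
  have class_bound: "n * (p - 1) \<le> p * card (I s)" if s: "s \<in> roots p" for s
  proof -
    define t where "t = cnj s * \<kappa>"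
    have t: "t \<in> roots p" using s \<kappa> p0 by (simp add: t_def roots_mult cnj_roots(3))
    have st: "s * y = \<kappa> \<longleftrightarrow> y = t" for y
    proof -
      have "cnj s * s = 1" by (rule cnj_roots(2)[OF p0 s])
      then show ?thesis unfolding t_def
        by (metis mult.assoc mult.commute mult.right_neutral)
    qed
    have prod_eq: "\<chi> (v i) * \<chi> w = \<kappa>"
      if "i \<in> {1..k}" "w \<in> Bset n p" "dotp n (v i) w = 0" for i w
      using dotp_eq_0_imp_prod[OF p vB that(2,3)] that(1) by (simp add: \<chi>_def \<kappa>_def)
    \<comment> \<open>\<open>u y\<close> has coordinate product \<open>y\<close>; since 1 and
      \<open>?z\<close> differ, one of them yields a vector off the level set of
      \<open>t\<close>.\<close>
    define u where "u = (\<lambda>y l. if l = 0 then y else if l < n then 1 else 0 :: complex)"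
    have uB: "u y \<in> Bset n p" if "y \<in> roots p" for y
      using that n one_in_roots[OF p0] by (auto simp: Bset_def u_def)
    have "\<chi> (u y) = y" for y
    proof -
      have "\<chi> (u y) = (\<Prod>l<n. if l = 0 then y else 1)"
        unfolding \<chi>_def by (intro prod.cong) (auto simp: u_def)
      then show ?thesis using n by simp
    qed
    moreover have "?z \<noteq> 1" using primitive_root_power_eq_1_iff[OF p0, of 1] p1 by simp
    ultimately obtain w0 where w0: "w0 \<in> Bset n p" "\<chi> w0 \<noteq> t"
      using uB[OF one_in_roots[OF p0]] uB[OF primitive_root_in_roots[OF p0]] by metis
    show ?thesis
    proof (rule level_set_cover_bound[OF p0 _ t])
      show "finite (I s)" by (simp add: I_def)
      show "\<exists>i\<in>I s. dotp n (v i) w = 0" if w: "w \<in> Bset n p" "(\<Prod>l<n. w l) = t" for w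
      proof -
        obtain i where i: "i \<in> {1..k}" "dotp n (v i) w = 0"
          using cov w(1) by (auto simp: orthogonal_cover_def)
        \<comment> \<open>Cancelling \<open>t\<close> puts the covering index into class
          \<open>s\<close>, so each class covers its level set alone.\<close>
        have "\<chi> (v i) * t = s * t"
          using prod_eq[OF i(1) w(1) i(2)] w(2) st[of t] by (simp add: \<chi>_def)
        moreover have "t \<noteq> 0" using cnj_roots(2)[OF p0 t] by auto
        ultimately show ?thesis using i by (auto simp: I_def)
      qed
      show "w0 \<in> Bset n p" by (rule w0(1))
      show "dotp n (v i) w0 \<noteq> 0" if "i \<in> I s" for i
        using that prod_eq[OF _ w0(1)] st w0(2) by (auto simp: I_def)
    qed
  qed
  have "p * (n * (p - 1)) = (\<Sum>s\<in>roots p. n * (p - 1))"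
    using p0 card_roots_unity_eq[of p] by (simp add: roots_eq)
  also have "\<dots> \<le> (\<Sum>s\<in>roots p. p * card (I s))" by (intro sum_mono class_bound)
  also have "\<dots> = p * (\<Sum>s\<in>roots p. \<Sum>i\<in>{i \<in> {1..k}. \<chi> (v i) = s}. 1)"
    by (simp add: sum_distrib_left I_def)
  also have "(\<Sum>s\<in>roots p. \<Sum>i\<in>{i \<in> {1..k}. \<chi> (v i) = s}. 1) = (\<Sum>i\<in>{1..k}. 1 :: nat)"
    by (rule sum.group) (use vB prod_Bset_in_roots[OF p0] finite_roots[OF p0] in \<open>auto simp: \<chi>_def\<close>)
  finally show ?thesis using p0 by simp
qed

theorem theorem1:
  fixes n p :: nat
  assumes "n > 0" and "prime p" and "p dvd n"
  shows "Kval n p \<ge> n * (p - 1)"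
proof -
  have "\<exists>k v. orthogonal_cover n p k v"
    using ex_orthogonal_cover assms prime_gt_1_nat by blast
  then have "\<exists>v. orthogonal_cover n p (Kval n p) v"
    unfolding Kval_def orthogonal_cover_def by (rule LeastI_ex)
  then show ?thesis using orthogonal_cover_size assms by blast
qed

end
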